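(* For each integer $k>0$, the language $W_k\subseteq\{a,b\}^*$ is definable by a tree in $\mathrm{ADT}_{k+1}$ but is not definable by any tree in $\mathrm{ADT}_{k-2}$; i.e. $W_k\in\mathrm{ADT}_{k+1}\setminus\mathrm{ADT}_{k-2}$ (with $\mathrm{ADT}_{-1}=\emptyset$).
   Context: Let $\mathrm{Prop}=\{p\}$ and let $\Sigma=2^{\mathrm{Prop}}=\{a,b\}$ where $a=\{p\}$ and $b=\emptyset$ (valuations); $\top := p\lor\neg p$, $\bot:=\neg\top$. A trace is a word in $\Sigma^*$; $\varepsilon$ is the empty trace. For $w\in\{a,b\}^*$ let $\|w\|$ be the number of occurrences of $a$ minus the number of occurrences of $b$ in $w$. $W_k$ is the set of $w\in\{a,b\}^*$ such that $\|w\|=0$; every prefix $w'$ of $w$ satisfies $0\le\|w'\|\le k$; and some prefix $w''$ of $w$ satisfies $\|w''\|=k$. The set $\mathrm{ADT}$ of attack-defense trees is defined inductively: the special leaf $\epsilon$ and every propositional formula $\gamma$ over $\mathrm{Prop}$ are in $\mathrm{ADT}$; if $\theta_1,\dots,\theta_n\in\mathrm{ADT}$ then $\mathrm{OR}(\theta_1,\dots,\theta_n)$, $\mathrm{SAND}(\theta_1,\dots,\theta_n)$, $\mathrm{AND}(\theta_1,\dots,\theta_n)\in\mathrm{ADT}$; if $\theta,\theta'\in\mathrm{ADT}$ then $\mathrm{C}(\theta,\theta')\in\mathrm{ADT}$. Semantics $[\![\theta]\!]\subseteq\Sigma^*$: $[\![\epsilon]\!]=\{\varepsilon\}$; $[\![\gamma]\!]=\{v_1\cdots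 v_n\in\Sigma^* : n\ge 1,\ v_n\models\gamma\}$; $\mathrm{OR}$ is interpreted as union, $\mathrm{SAND}$ as concatenation (in the given order), $[\![\mathrm{C}(\theta_1,\theta_2)]\!]=[\![\theta_1]\!]\setminus[\![\theta_2]\!]$, and $[\![\mathrm{AND}(\theta_1,\dots,\theta_n)]\!]=\bigcup_{i}\big([\![\theta_i]\!]\cap\bigcap_{j\ne i}[\![\theta_j]\!]\cdot\Sigma^*\big)$. Countermeasure-depth: $\mathrm{cd}(\epsilon)=\mathrm{cd}(\gamma)=0$; $\mathrm{cd}(\mathrm{OP}(\theta_1,\dots,\theta_n))=\max_i\mathrm{cd}(\theta_i)$ for $\mathrm{OP}\in\{\mathrm{OR},\mathrm{SAND},\mathrm{AND}\}$; $\mathrm{cd}(\mathrm{C}(\theta_1,\theta_2))=\max\{\mathrm{cd}(\theta_1),\mathrm{cd}(\theta_2)+1\}$. $\mathrm{ADT}_k=\{\theta\in\mathrm{ADT}:\mathrm{cd}(\theta)\le k\}$; a language $L$ is definable in $\mathrm{ADT}_k$ if $L=[\![\theta]\!]$ for some $\theta\in\mathrm{ADT}_k$. *)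

theory Defs
  imports "HOL-Library.Sublist"
begin

datatype 'p form =
    Atom 'p
  | Neg "'p form"
  | Conj "'p form" "'p form"
  | Disj "'p form" "'p form"

text \<open>A valuation is the set of propositions it makes true.\<close>

primrec models :: "'p set \<Rightarrow> 'p form \<Rightarrow> bool" (infix "\<Turnstile>" 50) where
  "v \<Turnstile> Atom q \<longleftrightarrow> q \<in> v"
| "v \<Turnstile> Neg \<gamma> \<longleftrightarrow> \<not> v \<Turnstile> \<gamma>"
| "v \<Turnstile> Conj \<gamma> \<delta> \<longleftrightarrow> v \<Turnstile> \<gamma> \<and> v \<Turnstile> \<delta>"
| "v \<Turnstile> Disj \<gamma> \<delta> \<longleftrightarrow> v \<Turnstile> \<gamma> \<or> v \<Turnstile> \<delta>"

text \<open>Every set of propositions is a letter, so the set of all traces is \<open>UNIV\<close>.\<close>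

type_synonym 'p trace = "'p set list"

definition conc :: "'p trace set \<Rightarrow> 'p trace set \<Rightarrow> 'p trace set" (infixr "\<cdot>" 75) where
  "K \<cdot> L = {u @ v | u v. u \<in> K \<and> v \<in> L}"

text \<open>
  The datatype also contains operator nodes without children; these are not trees of the
  formalism (a maximum over no children is meaningless) and are excluded by the set \<open>ADT\<close>.
\<close>

datatype 'p tree =
    Eps
  | Leaf "'p form"
  | OR "'p tree list"
  | SAND "'p tree list"
  | AND "'p tree list"
  | Counter "'p tree" "'p tree"

inductive_set ADT :: "'p tree set" where
  "Eps \<in> ADT"
| "Leaf \<gamma> \<in> ADT"
| "ts \<noteq> [] \<Longrightarrow> \<forall>t \<in> set ts. t \<in> ADT \<Longrightarrow> OR ts \<in> ADT"
| "ts \<noteq> [] \<Longrightarrow> \<forall>t \<in> set ts. t \<in> ADT \<Longrightarrow> SAND ts \<in> ADT"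
| "ts \<noteq> [] \<Longrightarrow> \<forall>t \<in> set ts. t \<in> ADT \<Longrightarrow> AND ts \<in> ADT"
| "t \<in> ADT \<Longrightarrow> t' \<in> ADT \<Longrightarrow> Counter t t' \<in> ADT"

definition AND_lang :: "'p trace set list \<Rightarrow> 'p trace set" where
  "AND_lang Ls =
    (\<Union>i<length Ls. Ls ! i \<inter> (\<Inter>j \<in> {..<length Ls} - {i}. Ls ! j \<cdot> UNIV))"

primrec sem :: "'p tree \<Rightarrow> 'p trace set" where
  "sem Eps = {[]}"
| "sem (Leaf \<gamma>) = {w. w \<noteq> [] \<and> last w \<Turnstile> \<gamma>}"
| "sem (OR ts) = \<Union> (set (map sem ts))"
| "sem (SAND ts) = foldr (\<cdot>) (map sem ts) {[]}"
| "sem (AND ts) = AND_lang (map sem ts)"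
| "sem (Counter t t') = sem t - sem t'"

primrec cd :: "'p tree \<Rightarrow> nat" where
  "cd Eps = 0"
| "cd (Leaf \<gamma>) = 0"
| "cd (OR ts) = Max (set (map cd ts))"
| "cd (SAND ts) = Max (set (map cd ts))"
| "cd (AND ts) = Max (set (map cd ts))"
| "cd (Counter t t') = max (cd t) (cd t' + 1)"

text \<open>The bound is an integer, so that the set is empty for negative bounds.\<close>

definition ADT_upto :: "int \<Rightarrow> 'p tree set" where
  "ADT_upto k = {t \<in> ADT. int (cd t) \<le> k}"

definition definable_in :: "'p trace set \<Rightarrow> 'p tree set \<Rightarrow> bool" where
  "definable_in L T \<longleftrightarrow> (\<exists>t \<in> T. L = sem t)"

datatype ap = AP_p

definition letter_a :: "ap set" where "letter_a = {AP_p}"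

definition letter_b :: "ap set" where "letter_b = {}"

definition balance :: "ap trace \<Rightarrow> int" where
  "balance w = int (count_list w letter_a) - int (count_list w letter_b)"

definition W :: "int \<Rightarrow> ap trace set" where
  "W k = {w. balance w = 0 \<and>
             (\<forall>u. prefix u w \<longrightarrow> 0 \<le> balance u \<and> balance u \<le> k) \<and>
             (\<exists>u. prefix u w \<and> balance u = k)}"

end

theory Submission
  imports Defs
begin

text \<open>
  Upper bound: a word that climbs by \<open>k + 2\<close> contains a shortest such factor, which has the form
  \<open>a v a\<close> where \<open>v\<close> climbs by exactly \<open>k\<close> without leaving its band; dually for descents.
  Forbidding these factors confines a word to a band of width \<open>k + 1\<close>, and the position
  of its end points in the band is controlled by forbidding prefixes and suffixes built from words
  confined to a band of width \<open>k\<close>. Hence each additional unit of width costs one nested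
  complement.

  Lower bound: trees of countermeasure-depth at most \<open>n\<close> are monotone for an
  Ehrenfeucht--Fraisse-style preorder of level \<open>n\<close>, in which a split of the smaller word is
  answered by a split of the larger one and the two words may change roles at most \<open>n\<close> times.
  If \<open>v\<close> is below \<open>u\<close> at level \<open>n\<close>, then for large \<open>N\<close> the word
  \<open>u^N\<close> is below \<open>u^N v u^N\<close> at level \<open>n + 1\<close>. Taking \<open>u = Q b\<close> and
  \<open>v = P b\<close> (or \<open>u = Q a\<close> and \<open>v = P a\<close>) for a pair \<open>P\<close>, \<open>Q\<close> of level
  \<open>n\<close> whose balances differ by one gives a pair of level \<open>n + 1\<close> living in a band
  that is wider by one.
\<close>

section \<open>Heights\<close>

text \<open>The letter is a parameter because every fact about ascents then yields the dual fact
  about descents by passing to \<open>- c\<close>, the only other letter.\<close>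

definition rise :: "ap set \<Rightarrow> ap trace \<Rightarrow> int" where
  "rise c w = sum_list (map (\<lambda>x. if x = c then 1 else - 1) w)"

lemma rise_simps [simp]:
  "rise c [] = 0"
  "rise c (x # w) = (if x = c then 1 else - 1) + rise c w"
  "rise c (u @ v) = rise c u + rise c v"
  by (simp_all add: rise_def)

lemma ap_set_cases: "(x :: ap set) = {} \<or> x = UNIV"
proof -
  have "y = AP_p" for y by (cases y)
  then show ?thesis by (metis UNIV_eq_I subsetI subset_empty)
qed

lemma neq_letter_iff: "x \<noteq> c \<longleftrightarrow> x = - c" for c x :: "ap set"
  using ap_set_cases[of x] ap_set_cases[of c] by auto

lemma letter_a_UNIV: "letter_a = UNIV"
  using ap_set_cases[of letter_a] by (auto simp: letter_a_def)

lemma minus_letter_a [simp]: "- letter_a = letter_b"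
  by (simp add: letter_a_UNIV letter_b_def)

lemma minus_letter_neq [simp]: "- c \<noteq> c" "c \<noteq> - c" for c :: "ap set"
  using neq_letter_iff[of c c] by auto

lemma rise_minus [simp]: "rise (- c) w = - rise c w"
proof (induction w)
  case (Cons x w)
  then show ?case using neq_letter_iff[of x c] by auto
qed simp

lemma balance_eq_rise: "balance w = rise letter_a w"
proof (induction w)
  case (Cons x w)
  then show ?case using neq_letter_iff[of x letter_a] minus_letter_neq[of letter_a]
    by (auto simp: balance_def)
qed (simp add: balance_def)

text \<open>Heights are measured from the start of the word, and bounds may be negative, so that a
  later factor of a confined word is again confined, with both bounds shifted
  (\<open>band_append\<close>).\<close>

definition band :: "ap set \<Rightarrow> int \<Rightarrow> int \<Rightarrow> ap trace \<Rightarrow> bool" where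
  "band c lo hi w \<longleftrightarrow> (\<forall>u. prefix u w \<longrightarrow> lo \<le> rise c u \<and> rise c u \<le> hi)"

lemma bandI: "(\<And>u v. w = u @ v \<Longrightarrow> lo \<le> rise c u \<and> rise c u \<le> hi) \<Longrightarrow> band c lo hi w"
  by (auto simp: band_def prefix_def)

lemma bandD:
  assumes "band c lo hi (u @ v)"
  shows "lo \<le> rise c u" "rise c u \<le> hi"
  using assms by (auto simp: band_def)

lemma band_Nil [simp]: "band c lo hi [] \<longleftrightarrow> lo \<le> 0 \<and> 0 \<le> hi"
  by (simp add: band_def)

lemma band_append:
  "band c lo hi (u @ v) \<longleftrightarrow>
    band c lo hi u \<and> band c (lo - rise c u) (hi - rise c u) v"
proof -
  have "band c lo hi (u @ v) \<longleftrightarrow> band c lo hi u \<and>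
      (\<forall>w. prefix w v \<longrightarrow> lo \<le> rise c (u @ w) \<and> rise c (u @ w) \<le> hi)"
    unfolding band_def prefix_append by blast
  then show ?thesis by (simp add: band_def algebra_simps)
qed

lemma band_zero:
  assumes "band c lo hi w"
  shows "lo \<le> 0" "0 \<le> hi"
  using bandD[of c lo hi "[]" w] assms by simp_all

lemma band_single [simp]:
  "band c lo hi [x] \<longleftrightarrow>
    lo \<le> 0 \<and> 0 \<le> hi \<and> (if x = c then 1 \<le> hi else lo \<le> - 1)"
  by (auto simp: band_def prefix_Cons)

lemma band_Cons:
  "band c lo hi (x # w) \<longleftrightarrow>
    lo \<le> 0 \<and> 0 \<le> hi \<and>
    band c (lo - rise c [x]) (hi - rise c [x]) w"
proof -
  have "band c lo hi (x # w) \<longleftrightarrow> band c lo hi [x] \<and> band c (lo - rise c [x]) (hi - rise c [x]) w"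
    using band_append[of c lo hi "[x]" w] by simp
  moreover have "lo - rise c [x] \<le> 0 \<and> 0 \<le> hi - rise c [x]"
    if "band c (lo - rise c [x]) (hi - rise c [x]) w"
    using band_zero[OF that] by blast
  ultimately show ?thesis by (auto split: if_splits)
qed

lemma band_mono: "band c lo hi w \<Longrightarrow> lo' \<le> lo \<Longrightarrow> hi \<le> hi' \<Longrightarrow> band c lo' hi' w"
  unfolding band_def by (meson order_trans)

text \<open>A first-passage principle: \<open>x\<close> is the letter whose reading makes
  \<open>P\<close> true for the first time.\<close>

lemma shortest_prefix:
  assumes "P (p @ r)" "\<not> P []"
  obtains q x s where "p @ r = q @ x # s" "P (q @ [x])"
    "\<And>u v. q = u @ v \<Longrightarrow> \<not> P u"
proof -
  have "\<exists>q x s. w = q @ x # s \<and> P (q @ [x]) \<and> (\<forall>u v. q = u @ v \<longrightarrow> \<not> P u)"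
    if "P w" for w
    using that
  proof (induction "length w" arbitrary: w rule: less_induct)
    case less
    show ?case
    proof (cases "\<exists>u v. w = u @ v \<and> v \<noteq> [] \<and> P u")
      case True
      then obtain u v where u: "w = u @ v" "v \<noteq> []" "P u" by blast
      then have "length u < length w" by simp
      from less(1)[OF this u(3)]
      obtain q x s where "u = q @ x # s" "P (q @ [x])" "\<forall>u v. q = u @ v \<longrightarrow> \<not> P u"
        by (elim exE conjE)
      then show ?thesis using \<open>w = u @ v\<close>
        by (intro exI[of _ q] exI[of _ x] exI[of _ "s @ v"]) simp
    next
      case False
      have "w \<noteq> []" using less(2) assms(2) by blast
      then obtain q x where q: "w = q @ [x]" by (metis rev_exhaust)
      have "\<not> P u" if "q = u @ v" for u v
      proof -
        have "w = u @ (v @ [x])" "v @ [x] \<noteq> []" using q that by simp_all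
        then show ?thesis using False by blast
      qed
      then show ?thesis using q less(2) by (intro exI[of _ q] exI[of _ x] exI[of _ "[]"]) simp
    qed
  qed
  from this[OF assms(1)] obtain q x s where q: "p @ r = q @ x # s" "P (q @ [x])"
    "\<forall>u v. q = u @ v \<longrightarrow> \<not> P u"
    by (elim exE conjE)
  show thesis by (rule that[OF q(1,2)]) (use q(3) in simp)
qed

lemma shortest_suffix:
  assumes "P w" "\<not> P []"
  obtains s x q where "w = s @ x # q" "P (x # q)"
    "\<And>u v. q = u @ v \<Longrightarrow> \<not> P v"
proof -
  obtain q x s where *: "rev w = q @ x # s" "P (rev (q @ [x]))"
    "\<And>u v. q = u @ v \<Longrightarrow> \<not> P (rev u)"
    using shortest_prefix[of "\<lambda>u. P (rev u)" "rev w" "[]"] assms by auto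
  have "w = rev s @ x # rev q" using arg_cong[OF *(1), of rev] by simp
  moreover have "\<not> P v" if "rev q = u @ v" for u v
    using *(3)[of "rev v" "rev u"] arg_cong[OF that, of rev] by simp
  ultimately show thesis using that *(2) by simp
qed

section \<open>Confined words\<close>

definition dyck :: "ap set \<Rightarrow> nat \<Rightarrow> ap trace set" where
  "dyck c k = {w. rise c w = 0 \<and> band c 0 (int k) w}"

definition climb :: "ap set \<Rightarrow> nat \<Rightarrow> ap trace set" where
  "climb c k = {w. rise c w = int k \<and> band c 0 (int k) w}"

text \<open>A positive concatenation form of "some factor rises by at least \<open>k + 2\<close>":
  \<open>c v c\<close> is the shape of a minimal such factor.\<close>

definition steep :: "ap set \<Rightarrow> nat \<Rightarrow> ap trace set" where
  "steep c k = UNIV \<cdot> {[c]} \<cdot> climb c k \<cdot> {[c]} \<cdot> UNIV"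

text \<open>All heights visited fit into some window of width \<open>k\<close>; where the start lies
  in it is left open, so the notion is invariant under \<open>c\<close> versus
  \<open>- c\<close>.\<close>

definition narrow :: "ap set \<Rightarrow> nat \<Rightarrow> ap trace \<Rightarrow> bool" where
  "narrow c k w \<longleftrightarrow> (\<forall>p v s. w = p @ v @ s \<longrightarrow> \<bar>rise c v\<bar> \<le> int k)"

lemma conc_letter_iff:
  "w \<in> K \<cdot> {[x]} \<cdot> L \<longleftrightarrow> (\<exists>u v. w = u @ x # v \<and> u \<in> K \<and> v \<in> L)"
  by (auto simp: conc_def)

lemma steep_iff: "w \<in> steep c k \<longleftrightarrow> (\<exists>p v s. w = p @ c # v @ c # s \<and> v \<in> climb c k)"
  by (auto simp: steep_def conc_def) blast+

lemma steep_factor: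
  "v \<in> steep c k \<Longrightarrow> p @ v @ s \<in> steep c k"
  unfolding steep_iff by (metis append.assoc append_Cons)

text \<open>Pass to a factor of rise at least \<open>k + 2\<close> none of whose proper factors has
  such a rise. Minimality forces both outer letters to be \<open>c\<close> and confines the part
  between them.\<close>

lemma steepI: "int k + 2 \<le> rise c v \<Longrightarrow> v \<in> steep c k"
proof (induction "length v" arbitrary: v rule: less_induct)
  case less
  show ?case
  proof (cases "\<exists>p u s. v = p @ u @ s \<and> length u < length v \<and> int k + 2 \<le> rise c u")
    case True
    then show ?thesis using less(1) steep_factor by blast
  next
    case False
    then have *: "rise c u \<le> int k + 1" if "v = p @ u @ s" "p \<noteq> [] \<or> s \<noteq> []" for p u s
      using that by force
    have "v \<noteq> []" using less(2) by auto
    then obtain x v' where v': "v = x # v'" by (cases v) auto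
    have "v' \<noteq> []" using less(2) v' by (auto split: if_splits)
    then obtain z y where z: "v' = z @ [y]" by (metis rev_exhaust)
    have v: "v = x # z @ [y]" using v' z by simp
    \<comment> \<open>Proper prefixes and suffixes rise by at most \<open>k + 1\<close>, the whole
      by at least \<open>k + 2\<close>; subtracting a suffix gives the lower bound 1.\<close>
    have pre: "1 \<le> rise c (x # z1) \<and> rise c (x # z1) \<le> int k + 1" if "z = z1 @ z2" for z1 z2
    proof -
      have "rise c (z2 @ [y]) \<le> int k + 1" using *[of "x # z1" "z2 @ [y]" "[]"] that v by simp
      moreover have "rise c (x # z1) + rise c (z2 @ [y]) = rise c v" using that v by simp
      moreover have "rise c (x # z1) \<le> int k + 1"
        using *[of "[]" "x # z1" "z2 @ [y]"] that v by simp
      ultimately show ?thesis using less(2) by linarith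
    qed
    have x: "x = c" using pre[of "[]" z] by (auto split: if_splits)
    have y: "y = c" using pre[of z "[]"] less(2) v by (auto split: if_splits)
    have "rise c z = int k" using pre[of z "[]"] less(2) v x y by auto
    moreover have "band c 0 (int k) z" using pre x by (intro bandI) fastforce
    ultimately have "z \<in> climb c k" by (simp add: climb_def)
    then show ?thesis unfolding steep_iff using v x y by fastforce
  qed
qed

lemma narrow_iff: "narrow c (Suc k) w \<longleftrightarrow> w \<notin> steep c k \<union> steep (- c) k"
proof
  assume n: "narrow c (Suc k) w"
  have "rise c v \<le> int k + 1 \<and> - rise c v \<le> int k + 1" if "w = p @ v @ s" for p v s
    using n that unfolding narrow_def by fastforce
  \<comment> \<open>The factor in question is \<open>c # v @ [c]\<close> or its dual, of rise plus
    or minus \<open>k + 2\<close>.\<close>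
  from this[of _ "_ # _ @ [_]"] show "w \<notin> steep c k \<union> steep (- c) k"
    by (fastforce simp: steep_iff climb_def)
next
  assume w: "w \<notin> steep c k \<union> steep (- c) k"
  show "narrow c (Suc k) w"
    unfolding narrow_def
  proof (intro allI impI)
    fix p v s
    assume "w = p @ v @ s"
    then have "v \<notin> steep c k" "v \<notin> steep (- c) k" using w steep_factor by blast+
    then show "\<bar>rise c v\<bar> \<le> int (Suc k)"
      using steepI[of k c v] steepI[of k "- c" v] by force
  qed
qed

lemma narrowD:
  assumes "narrow c k w" "w = p @ v @ s"
  shows "rise c v \<le> int k" "- int k \<le> rise c v"
  using assms by (fastforce simp: narrow_def)+

lemma band_narrow: "band c 0 (int k) w \<Longrightarrow> narrow c k w"
  unfolding narrow_def
proof (intro allI impI)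
  fix p v s
  assume "band c 0 (int k) w" "w = p @ v @ s"
  then show "\<bar>rise c v\<bar> \<le> int k"
    using bandD[of c 0 "int k" p "v @ s"] bandD[of c 0 "int k" "p @ v" s] by auto
qed

text \<open>Just before height 0 is first undercut, the word is at 0 and has never been negative. It
  has not exceeded \<open>k\<close> either, since the fall to -1 would then be larger than
  \<open>k + 1\<close>. So a forbidden prefix occurs.\<close>

lemma narrow_prefix_nonneg:
  assumes n: "narrow c (Suc k) (u @ v)" and "u @ v \<notin> dyck c k \<cdot> {[- c]} \<cdot> UNIV"
  shows "0 \<le> rise c u"
proof (rule ccontr)
  assume "\<not> 0 \<le> rise c u"
  then obtain q x s where q: "u @ [] = q @ x # s" "rise c (q @ [x]) < 0"
    "\<And>u v. q = u @ v \<Longrightarrow> \<not> rise c u < 0"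
    using shortest_prefix[of "\<lambda>u. rise c u < 0" u "[]"] by auto
  have nn: "0 \<le> rise c q" using q(3)[of q "[]"] by simp
  then have x: "x \<noteq> c" using q(2) by (auto split: if_splits)
  then have q0: "rise c q = 0" using q(2) nn by simp
  have "rise c q1 \<le> int k" if "q = q1 @ q2" for q1 q2
    using narrowD(2)[OF n, of q1 "q2 @ [x]" "s @ v"] q0 x q(1) that by simp
  then have "q \<in> dyck c k" using q(3) q0 by (fastforce simp: dyck_def intro: bandI)
  then show False using assms(2) q(1) x neq_letter_iff[of x c]
    unfolding conc_letter_iff by fastforce
qed

text \<open>The mirror argument, read from the right: the shortest suffix of positive rise is
  \<open>c\<close> followed by a word of \<open>dyck c k\<close>.\<close>

lemma narrow_suffix_nonpos:
  assumes n: "narrow c (Suc k) (u @ v)" and "u @ v \<notin> UNIV \<cdot> {[c]} \<cdot> dyck c k"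
  shows "rise c v \<le> 0"
proof (rule ccontr)
  assume "\<not> rise c v \<le> 0"
  then obtain s x q where q: "v = s @ x # q" "rise c (x # q) > 0"
    "\<And>u v. q = u @ v \<Longrightarrow> \<not> rise c v > 0"
    using shortest_suffix[of "\<lambda>u. rise c u > 0" v] by auto
  have np: "rise c q \<le> 0" using q(3)[of "[]" q] by simp
  then have x: "x = c" using q(2) by (auto split: if_splits)
  then have q0: "rise c q = 0" using q(2) np by simp
  have "0 \<le> rise c q1 \<and> rise c q1 \<le> int k" if "q = q1 @ q2" for q1 q2
    using narrowD(1)[OF n, of "u @ s" "x # q1" "q2"] q(3)[OF that] q0 x q(1) that by simp
  then have "q \<in> dyck c k" using q0 by (auto simp: dyck_def intro: bandI)
  then show False using assms(2) q(1) x unfolding conc_letter_iff by fastforce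
qed

text \<open>Cut just before height \<open>k\<close> is first exceeded.\<close>

lemma climb_prefix:
  assumes "band c 0 hi (u @ v)" "int k < rise c u"
  shows "u @ v \<in> climb c k \<cdot> {[c]} \<cdot> UNIV"
proof -
  obtain q x s where q: "u @ [] = q @ x # s" "rise c (q @ [x]) > int k"
    "\<And>u v. q = u @ v \<Longrightarrow> \<not> rise c u > int k"
    using shortest_prefix[of "\<lambda>u. rise c u > int k" u "[]"] assms(2) by auto
  have le: "rise c q \<le> int k" using q(3)[of q "[]"] by simp
  have x: "x = c" using q(2) le by (auto split: if_splits)
  have "rise c q = int k" using q(2) x le by simp
  moreover have "0 \<le> rise c q1 \<and> rise c q1 \<le> int k" if "q = q1 @ q2" for q1 q2
    using q(3)[OF that] bandD(1)[of c 0 hi q1 "q2 @ x # s @ v"] assms(1) q(1) that by simp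
  ultimately have "q \<in> climb c k" by (auto simp: climb_def intro: bandI)
  then show ?thesis using q(1) x unfolding conc_letter_iff by fastforce
qed

lemma dyck_0: "dyck c 0 = {[]}" and climb_0: "climb c 0 = {[]}"
proof -
  have "w = []" if "band c 0 0 w" for w
    using that bandD[of c 0 0 "[hd w]" "tl w"] by (cases w) (auto split: if_splits)
  then show "dyck c 0 = {[]}" "climb c 0 = {[]}" by (auto simp: dyck_def climb_def)
qed

text \<open>The \<open>steep\<close> terms bound the width, the forbidden prefixes keep heights
  nonnegative, and the forbidden suffixes keep the final height from being positive. Only
  level-\<open>k\<close> languages are subtracted, so one complement is spent.\<close>

lemma dyck_Suc:
  "dyck c (Suc k) =
    UNIV - (steep c k \<union> steep (- c) k \<union> dyck c k \<cdot> {[- c]} \<cdot> UNIV \<union> UNIV \<cdot> {[c]} \<cdot> dyck c k)"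
  (is "_ = UNIV - (_ \<union> _ \<union> ?A \<union> ?B)")
proof (intro set_eqI iffI)
  fix w assume w: "w \<in> dyck c (Suc k)"
  then have b: "band c 0 (int (Suc k)) w" and r: "rise c w = 0" by (auto simp: dyck_def)
  have "w \<notin> ?A"
  proof
    assume "w \<in> ?A"
    then obtain u v where "w = u @ - c # v" "u \<in> dyck c k" unfolding conc_letter_iff by blast
    then show False using bandD(1)[of c 0 "int (Suc k)" "u @ [- c]" v] b by (simp add: dyck_def)
  qed
  moreover have "w \<notin> ?B"
  proof
    assume "w \<in> ?B"
    then obtain u v where "w = u @ c # v" "v \<in> dyck c k" unfolding conc_letter_iff by blast
    then show False using bandD(1)[of c 0 "int (Suc k)" u "c # v"] b r by (simp add: dyck_def)
  qed
  ultimately show "w \<in> UNIV - (steep c k \<union> steep (- c) k \<union> ?A \<union> ?B)"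
    using band_narrow[OF b] narrow_iff by blast
next
  fix w assume w: "w \<in> UNIV - (steep c k \<union> steep (- c) k \<union> ?A \<union> ?B)"
  then have n: "narrow c (Suc k) w" using narrow_iff by blast
  have nn: "0 \<le> rise c u" if "w = u @ v" for u v
    using narrow_prefix_nonneg[of c k u v] n w that by blast
  have "rise c w \<le> 0" using narrow_suffix_nonpos[of c k "[]" w] n w by simp
  then have "rise c w = 0" using nn[of w "[]"] by simp
  moreover have "band c 0 (int (Suc k)) w"
    using nn narrowD(1)[OF n, of "[]"] by (intro bandI) auto
  ultimately show "w \<in> dyck c (Suc k)" by (simp add: dyck_def)
qed

text \<open>The first term makes the word reach height \<open>k + 1\<close>. The forbidden suffixes
  prevent a net descent afterwards, and width \<open>k + 1\<close> prevents both a higher end and,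
  after that point, a fall below 0.\<close>

lemma climb_Suc:
  "climb c (Suc k) =
    climb c k \<cdot> {[c]} \<cdot> UNIV - (steep c k \<union> steep (- c) k \<union> UNIV \<cdot> {[- c]} \<cdot> dyck (- c) k)"
  (is "_ = ?P - (_ \<union> _ \<union> ?B)")
proof (intro set_eqI iffI)
  fix w assume w: "w \<in> climb c (Suc k)"
  then have b: "band c 0 (int (Suc k)) w" and r: "rise c w = int (Suc k)"
    by (auto simp: climb_def)
  have "w \<notin> ?B"
  proof
    assume "w \<in> ?B"
    then obtain u v where "w = u @ - c # v" "v \<in> dyck (- c) k"
      unfolding conc_letter_iff by blast
    then show False using bandD(2)[of c 0 "int (Suc k)" u "- c # v"] b r
      by (simp add: dyck_def)
  qed
  moreover have "w \<in> ?P" using climb_prefix[of c "int (Suc k)" w "[]" k] b r by simp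
  ultimately show "w \<in> ?P - (steep c k \<union> steep (- c) k \<union> ?B)"
    using band_narrow[OF b] narrow_iff by blast
next
  fix w assume w: "w \<in> ?P - (steep c k \<union> steep (- c) k \<union> ?B)"
  then have n: "narrow c (Suc k) w" using narrow_iff by blast
  then have n': "narrow (- c) (Suc k) w" by (simp add: narrow_def)
  have "w \<in> ?P" using w by blast
  then obtain p r where p: "w = p @ c # r" "p \<in> climb c k" unfolding conc_letter_iff by blast
  have "0 \<le> rise c r" using narrow_suffix_nonpos[of "- c" k "p @ [c]" r] n' w p(1) by simp
  then have "rise c w = int (Suc k)"
    using p narrowD(1)[OF n, of "[]" w "[]"] by (simp add: climb_def)
  moreover have "0 \<le> rise c u" if uv: "w = u @ v" for u v
  proof -
    from uv p(1) consider z where "p = u @ z" | z where "u = p @ c # z" "r = z @ v"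
      by (auto simp: append_eq_append_conv2 append_eq_Cons_conv Cons_eq_append_conv)
    then show ?thesis
    proof cases
      case 1
      then show ?thesis using p(2) bandD(1)[of c 0 "int k" u z] by (simp add: climb_def)
    next
      case 2
      then show ?thesis
        using p narrowD(2)[OF n, of "p @ [c]" z v] by (simp add: climb_def)
    qed
  qed
  then have "band c 0 (int (Suc k)) w"
    using narrowD(1)[OF n, of "[]"] by (intro bandI) auto
  ultimately show "w \<in> climb c (Suc k)" by (simp add: climb_def)
qed

lemma W_Suc: "W (int (Suc k)) = climb letter_a k \<cdot> {[letter_a]} \<cdot> UNIV \<inter> dyck letter_a (Suc k)"
proof (intro set_eqI iffI)
  fix w assume w: "w \<in> W (int (Suc k))"
  then have d: "w \<in> dyck letter_a (Suc k)"
    by (auto simp: W_def dyck_def band_def balance_eq_rise)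
  obtain u v where "w = u @ v" "rise letter_a u = int (Suc k)"
    using w by (auto simp: W_def prefix_def balance_eq_rise)
  then show "w \<in> climb letter_a k \<cdot> {[letter_a]} \<cdot> UNIV \<inter> dyck letter_a (Suc k)"
    using d climb_prefix[of letter_a "int (Suc k)" u v k] by (simp add: dyck_def)
next
  fix w assume w: "w \<in> climb letter_a k \<cdot> {[letter_a]} \<cdot> UNIV \<inter> dyck letter_a (Suc k)"
  then obtain p r where p: "w = (p @ [letter_a]) @ r" "p \<in> climb letter_a k"
    by (auto simp: conc_letter_iff)
  then have "prefix (p @ [letter_a]) w" "rise letter_a (p @ [letter_a]) = int (Suc k)"
    by (simp_all only: prefixI) (simp add: climb_def)
  then show "w \<in> W (int (Suc k))"
    using w unfolding W_def dyck_def band_def balance_eq_rise by blast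
qed

section \<open>Definability of confined words\<close>

lemma definable_mono:
  "definable_in L (ADT_upto m) \<Longrightarrow> m \<le> n \<Longrightarrow> definable_in L (ADT_upto n)"
  by (fastforce simp: definable_in_def ADT_upto_def)

lemma definable_Un:
  assumes "definable_in K (ADT_upto n)" "definable_in L (ADT_upto n)"
  shows "definable_in (K \<union> L) (ADT_upto n)"
proof -
  obtain s t where "s \<in> ADT_upto n" "K = sem s" "t \<in> ADT_upto n" "L = sem t"
    using assms unfolding definable_in_def by blast
  then show ?thesis
    unfolding definable_in_def
    by (intro bexI[of _ "OR [s, t]"]) (auto simp: ADT_upto_def intro!: ADT.intros)
qed

lemma conc_Eps [simp]: "L \<cdot> {[]} = L"
  by (auto simp: conc_def)

lemma definable_conc:
  assumes "definable_in K (ADT_upto n)" "definable_in L (ADT_upto n)"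
  shows "definable_in (K \<cdot> L) (ADT_upto n)"
proof -
  obtain s t where "s \<in> ADT_upto n" "K = sem s" "t \<in> ADT_upto n" "L = sem t"
    using assms unfolding definable_in_def by blast
  then show ?thesis
    unfolding definable_in_def
    by (intro bexI[of _ "SAND [s, t]"]) (auto simp: ADT_upto_def intro!: ADT.intros)
qed

lemma definable_Diff:
  assumes "definable_in K (ADT_upto (n + 1))" "definable_in L (ADT_upto n)"
  shows "definable_in (K - L) (ADT_upto (n + 1))"
proof -
  obtain s t where "s \<in> ADT_upto (n + 1)" "K = sem s" "t \<in> ADT_upto n" "L = sem t"
    using assms unfolding definable_in_def by blast
  then show ?thesis
    unfolding definable_in_def
    by (intro bexI[of _ "Counter s t"]) (auto simp: ADT_upto_def intro!: ADT.intros)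
qed

lemma definable_Eps: "0 \<le> n \<Longrightarrow> definable_in {[]} (ADT_upto n)"
  unfolding definable_in_def
  by (intro bexI[of _ Eps]) (auto simp: ADT_upto_def intro!: ADT.intros)

lemma definable_Leaf: "0 \<le> n \<Longrightarrow> definable_in {w. w \<noteq> [] \<and> last w \<Turnstile> \<gamma>} (ADT_upto n)"
  unfolding definable_in_def
  by (intro bexI[of _ "Leaf \<gamma>"]) (auto simp: ADT_upto_def intro!: ADT.intros)

lemma definable_nonempty: "0 \<le> n \<Longrightarrow> definable_in {w :: 'p trace. w \<noteq> []} (ADT_upto n)"
  using definable_Leaf[of n "Disj (Atom undefined) (Neg (Atom undefined)) :: 'p form"] by simp

lemma definable_UNIV: "0 \<le> n \<Longrightarrow> definable_in UNIV (ADT_upto n)"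
proof -
  have "UNIV = {[]} \<union> {w. w \<noteq> []}" by auto
  then show "0 \<le> n \<Longrightarrow> definable_in UNIV (ADT_upto n)"
    using definable_Un[OF definable_Eps definable_nonempty] by metis
qed

text \<open>A leaf sees only the last letter, so length one is enforced by subtracting the words of
  length at least two. This costs one complement.\<close>

lemma definable_letter:
  fixes c :: "ap set"
  assumes "1 \<le> n"
  shows "definable_in {[c]} (ADT_upto n)"
proof -
  let ?\<gamma> = "if c = letter_a then Atom AP_p else Neg (Atom AP_p)"
  have sat: "x \<Turnstile> ?\<gamma> \<longleftrightarrow> x = c" for x :: "ap set"
    using ap_set_cases[of x] ap_set_cases[of c] by (auto simp: letter_a_UNIV)
  have "{w. w \<noteq> [] \<and> last w \<Turnstile> ?\<gamma>} - {w. w \<noteq> []} \<cdot> {w. w \<noteq> []} = {[c]}"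
  proof (intro set_eqI iffI)
    fix w assume w: "w \<in> {w. w \<noteq> [] \<and> last w \<Turnstile> ?\<gamma>} - {w. w \<noteq> []} \<cdot> {w. w \<noteq> []}"
    then obtain x v where "w = x # v" by (cases w) auto
    moreover have "v = []"
    proof (rule ccontr)
      assume "v \<noteq> []"
      then have "[x] @ v \<in> {w. w \<noteq> []} \<cdot> {w. w \<noteq> []}" unfolding conc_def by blast
      then show False using w \<open>w = x # v\<close> by simp
    qed
    ultimately show "w \<in> {[c]}" using w sat by auto
  qed (auto simp: sat conc_def Cons_eq_append_conv)
  moreover have "definable_in ({w. w \<noteq> [] \<and> last w \<Turnstile> ?\<gamma>} - {w. w \<noteq> []} \<cdot> {w. w \<noteq> []}) (ADT_upto (0 + 1))"
    by (intro definable_Diff definable_conc definable_Leaf definable_nonempty) simp_all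
  ultimately show ?thesis using assms definable_mono[of _ 1 n] by simp
qed

text \<open>The offset 1 pays for the single letters, which already have depth 1 when they first
  occur under a complement.\<close>

lemma definable_dyck_climb:
  "definable_in (dyck c k) (ADT_upto (int k + 1)) \<and> definable_in (climb c k) (ADT_upto (int k + 1))"
proof (induction k arbitrary: c)
  case 0
  then show ?case by (simp add: dyck_0 climb_0 definable_Eps)
next
  case (Suc k)
  have le: "0 \<le> int k + 1" "0 \<le> (int k + 1) + 1" "1 \<le> int k + 1" "1 \<le> (int k + 1) + 1" by auto
  have dyck: "definable_in (dyck c k) (ADT_upto (int k + 1))"
    and climb: "definable_in (climb c k) (ADT_upto (int k + 1))"
    \<comment> \<open>\<open>climb c k\<close> occurs both under the complement and, one level
      higher, as part of the minuend.\<close>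
    and climb': "definable_in (climb c k) (ADT_upto ((int k + 1) + 1))" for c
    using Suc.IH[of c] definable_mono[of _ "int k + 1" "(int k + 1) + 1"] by auto
  have eq: "int (Suc k) + 1 = (int k + 1) + 1" by simp
  show ?case
    unfolding dyck_Suc climb_Suc steep_def eq
    by (intro conjI definable_Diff definable_Un definable_conc definable_letter definable_UNIV
        dyck climb climb' le)
qed

lemma definable_W: "definable_in (W (int (Suc k))) (ADT_upto (int (Suc k) + 1))"
proof -
  let ?c = letter_a
  let ?bad = "steep ?c k \<union> steep (- ?c) k \<union> dyck ?c k \<cdot> {[- ?c]} \<cdot> UNIV \<union> UNIV \<cdot> {[?c]} \<cdot> dyck ?c k"
  have le: "0 \<le> int k + 1" "0 \<le> (int k + 1) + 1" "1 \<le> int k + 1" "1 \<le> (int k + 1) + 1" by auto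
  have dyck: "definable_in (dyck c k) (ADT_upto (int k + 1))"
    and climb: "definable_in (climb c k) (ADT_upto (int k + 1))"
    and climb': "definable_in (climb c k) (ADT_upto ((int k + 1) + 1))" for c
    using definable_dyck_climb[of c k] definable_mono[of _ "int k + 1" "(int k + 1) + 1"] by auto
  \<comment> \<open>Intersecting with a complement is a difference, so the peak condition joins the
    one for \<open>dyck\<close> without further depth.\<close>
  have "W (int (Suc k)) = climb ?c k \<cdot> {[?c]} \<cdot> UNIV - ?bad"
    unfolding W_Suc dyck_Suc by blast
  moreover have "definable_in (climb ?c k \<cdot> {[?c]} \<cdot> UNIV - ?bad) (ADT_upto ((int k + 1) + 1))"
    unfolding steep_def
    by (intro definable_Diff definable_Un definable_conc definable_letter definable_UNIV
        dyck climb climb' le)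
  ultimately show ?thesis by (simp add: add.commute)
qed

section \<open>The game preorder\<close>

text \<open>The words may change roles \<open>n\<close> times, and \<open>m\<close> is the number of rounds.\<close>

primrec below :: "nat \<Rightarrow> nat \<Rightarrow> 'a list \<Rightarrow> 'a list \<Rightarrow> bool" where
  "below n 0 x y \<longleftrightarrow> (x = [] \<longleftrightarrow> y = []) \<and> (x \<noteq> [] \<longrightarrow> last x = last y)"
| "below n (Suc m) x y \<longleftrightarrow> below n m x y \<and>
    (\<forall>x1 x2. x = x1 @ x2 \<longrightarrow> (\<exists>y1 y2. y = y1 @ y2 \<and> below n m x1 y1 \<and> below n m x2 y2)) \<and>
    (\<forall>n'. n = Suc n' \<longrightarrow> below n' m y x)"

lemma below_SucI:
  assumes "below n m x y"
    and "\<And>x1 x2. x = x1 @ x2 \<Longrightarrow> \<exists>y1 y2. y = y1 @ y2 \<and> below n m x1 y1 \<and> below n m x2 y2"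
    and "\<And>n'. n = Suc n' \<Longrightarrow> below n' m y x"
  shows "below n (Suc m) x y"
  using assms by simp

lemma below_splitE:
  assumes "below n (Suc m) (x1 @ x2) y"
  obtains y1 y2 where "y = y1 @ y2" "below n m x1 y1" "below n m x2 y2"
  using assms unfolding below.simps by metis

lemma below_mono: "below n m x y \<Longrightarrow> m' \<le> m \<Longrightarrow> below n m' x y"
proof (induction m)
  case (Suc m)
  then show ?case by (cases "m' = Suc m") auto
qed simp

lemma below_refl [simp]: "below n m x x"
  by (induction m arbitrary: n x) auto

lemma below_trans: "below n m x y \<Longrightarrow> below n m y z \<Longrightarrow> below n m x z"
proof (induction m arbitrary: n x y z)
  case (Suc m)
  show ?case
  proof (rule below_SucI)
    show "below n m x z" using Suc by auto
    show "below n' m z x" if "n = Suc n'" for n' using Suc that by auto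
    fix x1 x2 assume "x = x1 @ x2"
    then obtain y1 y2 where y: "y = y1 @ y2" "below n m x1 y1" "below n m x2 y2"
      using Suc.prems(1) below_splitE by blast
    moreover obtain z1 z2 where "z = z1 @ z2" "below n m y1 z1" "below n m y2 z2"
      using Suc.prems(2) below_splitE unfolding y(1) by blast
    ultimately show "\<exists>z1 z2. z = z1 @ z2 \<and> below n m x1 z1 \<and> below n m x2 z2"
      using Suc.IH by blast
  qed
qed auto

text \<open>A cut of \<open>x @ y\<close> falls into one of the two factors and is answered in its
  counterpart; the other factor is carried along whole.\<close>

lemma below_append:
  "below n m x x' \<Longrightarrow> below n m y y' \<Longrightarrow> below n m (x @ y) (x' @ y')"
proof (induction m arbitrary: n x x' y y')
  case (Suc m)
  show ?case
  proof (rule below_SucI)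
    show "below n m (x @ y) (x' @ y')" using Suc by auto
    show "below n' m (x' @ y') (x @ y)" if "n = Suc n'" for n' using Suc that by auto
    fix z1 z2 assume "x @ y = z1 @ z2"
    then consider v where "x = z1 @ v" "z2 = v @ y" | v where "z1 = x @ v" "y = v @ z2"
      by (auto simp: append_eq_append_conv2)
    then show "\<exists>y1 y2. x' @ y' = y1 @ y2 \<and> below n m z1 y1 \<and> below n m z2 y2"
    proof cases
      case 1
      then obtain u1 u2 where "x' = u1 @ u2" "below n m z1 u1" "below n m v u2"
        using Suc.prems(1) below_splitE by blast
      moreover have "below n m (v @ y) (u2 @ y')"
        using Suc calculation by auto
      ultimately show ?thesis using 1 by (intro exI[of _ u1] exI[of _ "u2 @ y'"]) auto
    next
      case 2
      then obtain u1 u2 where "y' = u1 @ u2" "below n m v u1" "below n m z2 u2"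
        using Suc.prems(2) below_splitE by blast
      moreover have "below n m (x @ v) (x' @ u1)"
        using Suc calculation by auto
      ultimately show ?thesis using 2 by (intro exI[of _ "x' @ u1"] exI[of _ u2]) auto
    qed
  qed
qed auto

section \<open>Trees are monotone for the preorder\<close>

text \<open>The number of rounds may depend on the language, whereas \<open>n\<close>, the number of
  role changes, is what measures countermeasure-depth.\<close>

definition monotone_lang :: "nat \<Rightarrow> 'a list set \<Rightarrow> bool" where
  "monotone_lang n L \<longleftrightarrow> (\<exists>m. \<forall>x y. below n m x y \<longrightarrow> x \<in> L \<longrightarrow> y \<in> L)"

lemma monotone_langI: "(\<And>x y. below n m x y \<Longrightarrow> x \<in> L \<Longrightarrow> y \<in> L) \<Longrightarrow> monotone_lang n L"
  by (auto simp: monotone_lang_def)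

text \<open>Zero rounds suffice: they compare emptiness and the last letter, which is all a leaf can
  see.\<close>

lemma monotone_lang_basic:
  "monotone_lang n UNIV" "monotone_lang n {[]}"
  "monotone_lang n {w. w \<noteq> [] \<and> P (last w)}"
  by (rule monotone_langI[where m = 0]; auto)+

lemma monotone_lang_family:
  assumes "finite I" "\<And>i. i \<in> I \<Longrightarrow> monotone_lang n (L i)"
  shows "\<exists>m. \<forall>i \<in> I. \<forall>x y. below n m x y \<longrightarrow> x \<in> L i \<longrightarrow> y \<in> L i"
proof -
  have "\<forall>i \<in> I. \<exists>m. \<forall>x y. below n m x y \<longrightarrow> x \<in> L i \<longrightarrow> y \<in> L i"
    using assms(2) unfolding monotone_lang_def by blast
  then obtain f where f: "\<forall>i \<in> I. \<forall>x y. below n (f i) x y \<longrightarrow> x \<in> L i \<longrightarrow> y \<in> L i"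
    by (rule bchoice[THEN exE])
  have "y \<in> L i" if "i \<in> I" "below n (Max (f ` I)) x y" "x \<in> L i" for i x y
  proof -
    have "f i \<le> Max (f ` I)" using assms(1) that(1) by simp
    then show ?thesis using f that below_mono by blast
  qed
  then show ?thesis by blast
qed

lemma monotone_lang_UN:
  assumes "finite I" "\<And>i. i \<in> I \<Longrightarrow> monotone_lang n (L i)"
  shows "monotone_lang n (\<Union>i\<in>I. L i)"
proof -
  from monotone_lang_family[OF assms] obtain m
    where m: "\<forall>i \<in> I. \<forall>x y. below n m x y \<longrightarrow> x \<in> L i \<longrightarrow> y \<in> L i"
    by (rule exE)
  show ?thesis
  proof (rule monotone_langI)
    fix x y assume "below n m x y" "x \<in> (\<Union>i\<in>I. L i)"
    then show "y \<in> (\<Union>i\<in>I. L i)" using m by blast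
  qed
qed

lemma monotone_lang_INT:
  assumes "finite I" "\<And>i. i \<in> I \<Longrightarrow> monotone_lang n (L i)"
  shows "monotone_lang n (\<Inter>i\<in>I. L i)"
proof -
  from monotone_lang_family[OF assms] obtain m
    where m: "\<forall>i \<in> I. \<forall>x y. below n m x y \<longrightarrow> x \<in> L i \<longrightarrow> y \<in> L i"
    by (rule exE)
  show ?thesis
  proof (rule monotone_langI)
    fix x y assume "below n m x y" "x \<in> (\<Inter>i\<in>I. L i)"
    then show "y \<in> (\<Inter>i\<in>I. L i)" using m by blast
  qed
qed

lemma monotone_lang_Int:
  "monotone_lang n K \<Longrightarrow> monotone_lang n L \<Longrightarrow> monotone_lang n (K \<inter> L)"
  using monotone_lang_INT[of UNIV n "\<lambda>i. if i then K else L"]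
  by (simp add: UNIV_bool Int_commute)

text \<open>One extra round transports the factorisation.\<close>

lemma monotone_lang_conc:
  assumes "monotone_lang n K" "monotone_lang n L"
  shows "monotone_lang n (K \<cdot> L)"
proof -
  obtain p q where p: "\<And>x y. below n p x y \<Longrightarrow> x \<in> K \<Longrightarrow> y \<in> K"
    and q: "\<And>x y. below n q x y \<Longrightarrow> x \<in> L \<Longrightarrow> y \<in> L"
    using assms unfolding monotone_lang_def by blast
  show ?thesis
  proof (rule monotone_langI)
    fix x y assume xy: "below n (Suc (max p q)) x y" "x \<in> K \<cdot> L"
    then obtain x1 x2 where x: "x = x1 @ x2" "x1 \<in> K" "x2 \<in> L" by (auto simp: conc_def)
    then obtain y1 y2 where "y = y1 @ y2" "below n (max p q) x1 y1" "below n (max p q) x2 y2"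
      using xy(1) below_splitE by blast
    moreover from this have "y1 \<in> K" "y2 \<in> L"
      using p q x(2,3) below_mono by (meson max.cobounded1 max.cobounded2)+
    ultimately show "y \<in> K \<cdot> L" by (auto simp: conc_def)
  qed
qed

text \<open>If \<open>y\<close> were in \<open>L\<close>, one role change would put \<open>x\<close>
  into \<open>L\<close>; hence the subtrahend has one level less.\<close>

lemma monotone_lang_Diff:
  assumes "monotone_lang (Suc n) K" "monotone_lang n L"
  shows "monotone_lang (Suc n) (K - L)"
proof -
  obtain p q where p: "\<And>x y. below (Suc n) p x y \<Longrightarrow> x \<in> K \<Longrightarrow> y \<in> K"
    and q: "\<And>x y. below n q x y \<Longrightarrow> x \<in> L \<Longrightarrow> y \<in> L"
    using assms unfolding monotone_lang_def by blast
  show ?thesis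
  proof (rule monotone_langI)
    fix x y assume xy: "below (Suc n) (Suc (max p q)) x y" "x \<in> K - L"
    then have "below (Suc n) p x y" "below n q y x"
      using below_mono[of "Suc n" "max p q" x y p] below_mono[of n "max p q" y x q] by auto
    then show "y \<in> K - L" using p q xy(2) by blast
  qed
qed

lemma monotone_lang_AND_lang:
  assumes "\<And>L. L \<in> set Ls \<Longrightarrow> monotone_lang n L"
  shows "monotone_lang n (AND_lang Ls)"
  unfolding AND_lang_def
  by (intro monotone_lang_UN monotone_lang_Int monotone_lang_INT monotone_lang_conc
      monotone_lang_basic assms) auto

lemma Max_le_child: "Max (cd ` set ts) \<le> n \<Longrightarrow> t \<in> set ts \<Longrightarrow> cd t \<le> n"
  using Max_ge[of "cd ` set ts" "cd t"] by (meson List.finite_set finite_imageI imageI le_trans)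

lemma monotone_lang_sem: "cd t \<le> n \<Longrightarrow> monotone_lang n (sem t)"
proof (induction t arbitrary: n)
  case Eps
  then show ?case by (simp add: monotone_lang_basic)
next
  case (Leaf \<gamma>)
  then show ?case by (simp add: monotone_lang_basic(3)[of n "\<lambda>v. v \<Turnstile> \<gamma>"])
next
  case (OR ts)
  have "cd t \<le> n" if "t \<in> set ts" for t
    using OR.prems that by (simp add: Max_le_child)
  then have "monotone_lang n (\<Union>t\<in>set ts. sem t)"
    using OR.IH by (intro monotone_lang_UN) auto
  then show ?case by simp
next
  case (SAND ts)
  have "cd t \<le> n" if "t \<in> set ts" for t
    using SAND.prems that by (simp add: Max_le_child)
  then have "\<forall>t \<in> set ts. monotone_lang n (sem t)" using SAND.IH by blast
  then have "monotone_lang n (foldr (\<cdot>) (map sem ts) {[]})"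
    by (induction ts) (auto intro: monotone_lang_conc monotone_lang_basic)
  then show ?case by simp
next
  case (AND ts)
  have "cd t \<le> n" if "t \<in> set ts" for t
    using AND.prems that by (simp add: Max_le_child)
  then show ?case using AND.IH by (auto intro!: monotone_lang_AND_lang)
next
  case (Counter t t')
  then obtain n' where "n = Suc n'" "cd t' \<le> n'" by (cases n) auto
  then show ?case using Counter by (simp add: monotone_lang_Diff)
qed

section \<open>Powers\<close>

definition pow :: "nat \<Rightarrow> 'a list \<Rightarrow> 'a list" where
  "pow i u = concat (replicate i u)"

lemma pow_simps [simp]: "pow 0 u = []" "pow (Suc i) u = u @ pow i u"
  by (simp_all add: pow_def)

lemma pow_add: "pow (i + j) u = pow i u @ pow j u"
  by (induction i) auto

lemma pow_Suc_right: "pow (Suc i) u = pow i u @ u"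
  using pow_add[of i 1 u] by simp

lemma pow_split_at:
  assumes "i1 + 1 + i2 = i" "u = p @ s"
  shows "pow i u = (pow i1 u @ p) @ s @ pow i2 u"
proof -
  have "i = i1 + Suc i2" using assms(1) by simp
  then show ?thesis using assms(2) by (simp only: pow_add pow_simps append.assoc)
qed

lemma pow_eq_append:
  assumes "pow i u = x @ y" "0 < i"
  obtains i1 i2 p s where "u = p @ s" "i1 + 1 + i2 = i" "x = pow i1 u @ p" "y = s @ pow i2 u"
proof -
  have "\<exists>i1 i2 p s. u = p @ s \<and> i1 + 1 + i2 = i \<and> x = pow i1 u @ p \<and> y = s @ pow i2 u"
    using assms
  proof (induction i arbitrary: x)
    case (Suc i)
    then have "u @ pow i u = x @ y" by simp
    then consider v where "u = x @ v" "y = v @ pow i u"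
      | v where "x = u @ v" "pow i u = v @ y"
      by (auto simp: append_eq_append_conv2)
    then show ?case
    proof cases
      case 1
      then show ?thesis by (intro exI[of _ 0] exI[of _ i] exI[of _ x] exI[of _ v]) simp
    next
      case 2
      show ?thesis
      proof (cases "i = 0")
        case True
        then show ?thesis using 2
          by (intro exI[of _ 0] exI[of _ 0] exI[of _ u] exI[of _ "[]"]) simp
      next
        case False
        then obtain i1 i2 p s where
          "u = p @ s" "i1 + 1 + i2 = i" "v = pow i1 u @ p" "y = s @ pow i2 u"
          using Suc.IH[of v] 2 by blast
        then show ?thesis using 2
          by (intro exI[of _ "Suc i1"] exI[of _ i2] exI[of _ p] exI[of _ s]) simp
      qed
    qed
  qed simp
  then show thesis using that by blast
qed

lemma last_append_pow: "u \<noteq> [] \<Longrightarrow> 0 < i \<Longrightarrow> pow i u \<noteq> [] \<and> last (x @ pow i u) = last u"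
  by (cases i) (simp_all add: pow_Suc_right del: pow_simps(2))

text \<open>The reply to a cut with \<open>i\<close> copies on one side: imitate \<open>i\<close> if
  it is below the threshold \<open>t\<close>, otherwise take \<open>t\<close>. As \<open>j\<close>
  is at least \<open>3 * t\<close>, the other side keeps at least \<open>t\<close> copies.\<close>

lemma match_exponent:
  assumes "3 * t \<le> j" "0 < t"
  obtains j1 j2 where "j1 + 1 + j2 = j" "t \<le> j2" "i = j1 \<or> t \<le> i \<and> t \<le> (j1 :: nat)"
proof (cases "t \<le> i")
  case True
  then show thesis using assms that[of t "j - 1 - t"] by simp
next
  case False
  then show thesis using assms that[of i "j - 1 - i"] by simp
qed

text \<open>The threshold triples with each round because a cut of at least \<open>3 * t\<close>
  copies leaves at least \<open>t\<close> of them on one side.\<close>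

lemma below_pow: "3 ^ m \<le> i \<Longrightarrow> 3 ^ m \<le> j \<Longrightarrow> below n m (pow i u) (pow j u)"
proof (induction m arbitrary: n i j)
  case 0
  then show ?case using last_append_pow[of u _ "[]"] by (cases "u = []") (auto simp: pow_def)
next
  case (Suc m)
  let ?t = "3 ^ m :: nat"
  have t: "3 * ?t \<le> i" "3 * ?t \<le> j" "0 < ?t" using Suc.prems by auto
  have eq: "below n m (pow a u) (pow b u)" if "a = b \<or> ?t \<le> a \<and> ?t \<le> b" for n a b
    using that Suc.IH by auto
  show ?case
  proof (rule below_SucI)
    show "below n m (pow i u) (pow j u)" using t by (intro eq) auto
    show "below n' m (pow j u) (pow i u)" for n' using t by (intro eq) auto
    fix x1 x2 assume "pow i u = x1 @ x2"
    moreover have "0 < i" using t by linarith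
    ultimately obtain i1 i2 p s where i: "u = p @ s" "i1 + 1 + i2 = i"
      "x1 = pow i1 u @ p" "x2 = s @ pow i2 u"
      by (rule pow_eq_append)
    \<comment> \<open>On each side the two exponents agree or both exceed the threshold for the
      remaining rounds.\<close>
    have "\<exists>j1 j2. j1 + 1 + j2 = j \<and> (i1 = j1 \<or> ?t \<le> i1 \<and> ?t \<le> j1) \<and> (i2 = j2 \<or> ?t \<le> i2 \<and> ?t \<le> j2)"
    proof (cases "?t \<le> i2")
      case True
      then show ?thesis using match_exponent[OF t(2,3), of i1] by metis
    next
      case False
      then have "?t \<le> i1" using t i(2) by linarith
      moreover obtain j2 j1 where "j2 + 1 + j1 = j" "?t \<le> j1" "i2 = j2 \<or> ?t \<le> i2 \<and> ?t \<le> j2"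
        using match_exponent[OF t(2,3)] by metis
      ultimately show ?thesis by (intro exI[of _ j1] exI[of _ j2]) simp
    qed
    then obtain j1 j2 where j: "j1 + 1 + j2 = j" "i1 = j1 \<or> ?t \<le> i1 \<and> ?t \<le> j1"
      "i2 = j2 \<or> ?t \<le> i2 \<and> ?t \<le> j2" by blast
    have "below n m x1 (pow j1 u @ p)"
      unfolding i(3) by (intro below_append below_refl eq j)
    moreover have "below n m x2 (s @ pow j2 u)"
      unfolding i(4) by (intro below_append below_refl eq j)
    ultimately show "\<exists>y1 y2. pow j u = y1 @ y2 \<and> below n m x1 y1 \<and> below n m x2 y2"
      using pow_split_at[OF j(1) i(1)] by blast
  qed
qed

text \<open>As long as roles are kept, only cuts of the plain power must be answered, and
  \<open>v\<close> can stay hidden among many copies of \<open>u\<close>. It is exposed only by a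
  role change, and then \<open>v\<close> below \<open>u\<close> one level lower suffices. For
  \<open>n = 0\<close> any \<open>v\<close> may be inserted.\<close>

lemma below_pow_insert:
  assumes "u \<noteq> []" "\<And>n'. n = Suc n' \<Longrightarrow> below n' m v u"
    and "3 ^ m \<le> i" "3 ^ m \<le> j" "3 ^ m \<le> l"
  shows "below n m (pow i u) (pow j u @ v @ pow l u)"
  using assms(2-)
proof (induction m arbitrary: i j l)
  case 0
  then show ?case
    using assms(1) last_append_pow[of u i "[]"] last_append_pow[of u l "pow j u @ v"] by auto
next
  case (Suc m)
  let ?t = "3 ^ m :: nat"
  have t: "3 * ?t \<le> i" "3 * ?t \<le> j" "3 * ?t \<le> l" "0 < ?t" using Suc.prems by auto
  have t': "?t \<le> i" "?t \<le> j" "?t \<le> l" using t by auto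
  have vu: "below n' m v u" if "n = Suc n'" for n' using Suc.prems(1)[OF that] by simp
  have eq: "below n m (pow a u) (pow b u)" if "a = b \<or> ?t \<le> a \<and> ?t \<le> b" for n a b
    using that below_pow by auto
  note IH = Suc.IH[OF vu]
  show ?case
  proof (rule below_SucI)
    show "below n m (pow i u) (pow j u @ v @ pow l u)" using t' by (intro IH) auto
    show "below n' m (pow j u @ v @ pow l u) (pow i u)" if "n = Suc n'" for n'
    proof -
      \<comment> \<open>After the role change, replacing \<open>v\<close> by \<open>u\<close> leaves
        a plain power, comparable by \<open>below_pow\<close>.\<close>
      have "below n' m (pow j u @ v @ pow l u) (pow j u @ u @ pow l u)"
        by (intro below_append below_refl vu that)
      also have "pow j u @ u @ pow l u = pow (j + Suc l) u" by (simp only: pow_add pow_simps)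
      finally show ?thesis by (rule below_trans) (use t' in \<open>intro below_pow; linarith\<close>)
    qed
    fix x1 x2 assume "pow i u = x1 @ x2"
    moreover have "0 < i" using t by linarith
    ultimately obtain i1 i2 p s where i: "u = p @ s" "i1 + 1 + i2 = i"
      "x1 = pow i1 u @ p" "x2 = s @ pow i2 u"
      by (rule pow_eq_append)
    \<comment> \<open>The inserted \<open>v\<close> goes into a half that still has enough copies of
      \<open>u\<close>; the other half is compared as a plain power.\<close>
    show "\<exists>y1 y2. pow j u @ v @ pow l u = y1 @ y2 \<and> below n m x1 y1 \<and> below n m x2 y2"
    proof (cases "?t \<le> i2")
      case True
      obtain j1 j2 where j: "j1 + 1 + j2 = j" "?t \<le> j2" "i1 = j1 \<or> ?t \<le> i1 \<and> ?t \<le> j1"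
        using match_exponent[OF t(2,4)] by metis
      have "below n m x1 (pow j1 u @ p)"
        unfolding i(3) by (intro below_append below_refl eq j)
      moreover have "below n m x2 (s @ pow j2 u @ v @ pow l u)"
        unfolding i(4) using t' j True by (intro below_append below_refl IH)
      moreover have "pow j u @ v @ pow l u = (pow j1 u @ p) @ (s @ pow j2 u @ v @ pow l u)"
        by (simp add: pow_split_at[OF j(1) i(1)])
      ultimately show ?thesis by blast
    next
      case False
      then have i1: "?t \<le> i1" using t i(2) by linarith
      obtain l2 l1 where l: "l2 + 1 + l1 = l" "?t \<le> l1" "i2 = l2 \<or> ?t \<le> i2 \<and> ?t \<le> l2"
        using match_exponent[OF t(3,4)] by metis
      then have l': "l1 + 1 + l2 = l" by simp
      have "below n m (pow i1 u @ p) ((pow j u @ v @ pow l1 u) @ p)"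
        using t' l i1 by (intro below_append below_refl IH)
      moreover have "below n m x2 (s @ pow l2 u)"
        unfolding i(4) by (intro below_append below_refl eq l)
      moreover have "pow j u @ v @ pow l u = ((pow j u @ v @ pow l1 u) @ p) @ (s @ pow l2 u)"
        by (simp add: pow_split_at[OF l' i(1)])
      ultimately show ?thesis unfolding i(3) by blast
    qed
  qed
qed

section \<open>The separating pairs\<close>

lemma rise_pow: "rise c (pow i u) = int i * rise c u"
  by (induction i) (auto simp: algebra_simps)

lemma band_pow: "rise c u = 0 \<Longrightarrow> band c lo hi u \<Longrightarrow> band c lo hi (pow i u)"
  using band_zero[of c lo hi u] by (induction i) (auto simp: band_append)

lemma band_pow_insert:
  assumes "rise c u = 0" "band c lo hi u" "band c lo hi v"
    "band c (lo - rise c v) (hi - rise c v) u"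
  shows "band c lo hi (pow i u @ v @ pow i u)"
  using assms by (simp add: band_append rise_pow band_pow)

text \<open>The construction makes the sign of the rise of \<open>Q\<close> alternate with
  \<open>n\<close>. The window of \<open>Q\<close> extends that of \<open>P\<close> by one, on the
  side of its drift.\<close>

lemma separating_pair:
  fixes c :: "ap set"
  shows "\<exists>P Q lo. below n m P Q \<and> rise c P = 0 \<and> band c lo (lo + int n + 1) P \<and>
    (rise c Q = 1 \<and> band c lo (lo + int n + 2) Q \<or>
     rise c Q = - 1 \<and> band c (lo - 1) (lo + int n + 1) Q)"
proof (induction n)
  case 0
  let ?u = "[c, - c]" and ?N = "3 ^ m :: nat"
  have "below 0 m (pow ?N ?u) (pow ?N ?u @ [c] @ pow ?N ?u)"
    by (intro below_pow_insert) auto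
  moreover have "band c 0 (0 + int 0 + 1) (pow ?N ?u)"
    by (intro band_pow) (auto simp: band_Cons)
  moreover have "band c 0 (0 + int 0 + 2) (pow ?N ?u @ [c] @ pow ?N ?u)"
    by (intro band_pow_insert) (auto simp: band_Cons)
  moreover have "rise c (pow ?N ?u) = 0" "rise c (pow ?N ?u @ [c] @ pow ?N ?u) = 1"
    by (simp_all add: rise_pow)
  ultimately show ?case by blast
next
  case (Suc n)
  then obtain P Q lo where PQ: "below n m P Q" "rise c P = 0" "band c lo (lo + int n + 1) P"
    and Q: "rise c Q = 1 \<and> band c lo (lo + int n + 2) Q \<or>
      rise c Q = - 1 \<and> band c (lo - 1) (lo + int n + 1) Q" by blast
  note lo = band_zero[OF PQ(3)]
  let ?N = "3 ^ m :: nat"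
  \<comment> \<open>Appending the same letter keeps \<open>P\<close> below \<open>Q\<close> at level
    \<open>n\<close>, so inserting \<open>P @ [d]\<close> into powers of \<open>Q @ [d]\<close>
    gains a level.\<close>
  have step: "below (Suc n) m (pow ?N (Q @ [d])) (pow ?N (Q @ [d]) @ (P @ [d]) @ pow ?N (Q @ [d]))"
    for d
    by (intro below_pow_insert) (auto intro: below_append PQ(1))
  from Q show ?case
  proof
    assume Q: "rise c Q = 1 \<and> band c lo (lo + int n + 2) Q"
    \<comment> \<open>The added letter cancels the rise of \<open>Q\<close>, so powers of
      \<open>?u\<close> do not drift, and gives \<open>?v\<close> rise -1. The copies after
      \<open>?v\<close> start one lower, so the new window grows downwards.\<close>
    let ?u = "Q @ [- c]" and ?v = "P @ [- c]"
    have u: "rise c ?u = 0" "band c lo (lo + int n + 2) ?u"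
      using Q lo by (auto simp: band_append)
    have v: "rise c ?v = - 1" "band c (lo - 1) (lo + int n + 2) ?v"
      using PQ lo by (auto simp: band_append intro: band_mono)
    have "band c (lo - 1 - rise c ?v) (lo + int n + 2 - rise c ?v) ?u"
      unfolding v(1) by (rule band_mono[OF u(2)]) simp_all
    moreover have "band c (lo - 1) (lo + int n + 2) ?u" by (rule band_mono[OF u(2)]) simp_all
    ultimately have "band c (lo - 1) (lo + int n + 2) (pow ?N ?u @ ?v @ pow ?N ?u)"
      using u(1) v(2) band_pow_insert by blast
    moreover have "rise c (pow ?N ?u @ ?v @ pow ?N ?u) = - 1" "rise c (pow ?N ?u) = 0"
      using u v by (simp_all add: rise_pow)
    ultimately show ?thesis
      using step[of "- c"] band_pow[OF u]
      by (intro exI[of _ "pow ?N ?u"] exI[of _ "pow ?N ?u @ ?v @ pow ?N ?u"] exI[of _ lo])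
        (simp add: add.commute add.left_commute)
  next
    assume Q: "rise c Q = - 1 \<and> band c (lo - 1) (lo + int n + 1) Q"
    \<comment> \<open>Dually, the copies after \<open>?v\<close> start one higher; \<open>?u\<close>
      already descends to \<open>lo - 1\<close>, which becomes the new lower bound.\<close>
    let ?u = "Q @ [c]" and ?v = "P @ [c]"
    have u: "rise c ?u = 0" "band c (lo - 1) (lo + int n + 1) ?u"
      using Q lo by (auto simp: band_append)
    have v: "rise c ?v = 1" "band c (lo - 1) (lo + int n + 2) ?v"
      using PQ lo by (auto simp: band_append intro: band_mono)
    have "band c (lo - 1 - rise c ?v) (lo + int n + 2 - rise c ?v) ?u"
      unfolding v(1) by (rule band_mono[OF u(2)]) simp_all
    moreover have "band c (lo - 1) (lo + int n + 2) ?u" by (rule band_mono[OF u(2)]) simp_all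
    ultimately have "band c (lo - 1) (lo + int n + 2) (pow ?N ?u @ ?v @ pow ?N ?u)"
      using u(1) v(2) band_pow_insert by blast
    moreover have "rise c (pow ?N ?u @ ?v @ pow ?N ?u) = 1" "rise c (pow ?N ?u) = 0"
      using u v by (simp_all add: rise_pow)
    ultimately show ?thesis
      using step[of c] band_pow[OF u]
      by (intro exI[of _ "pow ?N ?u"] exI[of _ "pow ?N ?u @ ?v @ pow ?N ?u"] exI[of _ "lo - 1"])
        (simp add: add.commute add.left_commute)
  qed
qed

lemma rise_replicate: "rise c (replicate i c) = int i" "rise c (replicate i (- c)) = - int i"
  by (induction i) auto

lemma band_replicate:
  "lo \<le> 0 \<Longrightarrow> int i \<le> hi \<Longrightarrow> band c lo hi (replicate i c)"
  "lo \<le> - int i \<Longrightarrow> 0 \<le> hi \<Longrightarrow> band c lo hi (replicate i (- c))"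
  by (induction i arbitrary: lo hi) (auto simp: band_Cons)

text \<open>A common context lifts level \<open>lo\<close> to height 0 and restores the balance at
  the end. It puts \<open>P\<close> into the language, but not \<open>Q\<close>, whose nonzero rise
  survives.\<close>

lemma not_monotone_W: "\<not> monotone_lang n (W (int (Suc n)))"
proof
  assume "monotone_lang n (W (int (Suc n)))"
  then obtain m where m: "\<And>x y. below n m x y \<Longrightarrow> x \<in> W (int (Suc n)) \<Longrightarrow> y \<in> W (int (Suc n))"
    unfolding monotone_lang_def by blast
  let ?a = letter_a and ?b = "- letter_a"
  obtain P Q lo where PQ: "below n m P Q" "rise ?a P = 0" "band ?a lo (lo + int n + 1) P"
    "rise ?a Q \<noteq> 0"
    using separating_pair[of n m ?a] by force
  note lo = band_zero[OF PQ(3)]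
  \<comment> \<open>The initial peak makes the word reach level \<open>n + 1\<close>, whether or not \<open>P\<close> does.\<close>
  let ?wrap = "\<lambda>w. replicate (Suc n) ?a @ replicate (Suc n) ?b @ replicate (nat (- lo)) ?a @ w @
    replicate (nat (- lo)) ?b"
  have "below n m (?wrap P) (?wrap Q)" by (intro below_append below_refl PQ(1))
  moreover have "?wrap P \<in> W (int (Suc n))"
  proof -
    have "rise ?a (?wrap P) = 0"
      using PQ(2) by (simp add: rise_replicate del: replicate_Suc minus_letter_a)
    moreover have "band ?a 0 (int (Suc n)) (?wrap P)"
      using PQ(2) lo band_mono[OF PQ(3), of lo "int n + 1 + lo"]
      by (simp add: band_append rise_replicate band_replicate del: replicate_Suc minus_letter_a)
    moreover have "prefix (replicate (Suc n) ?a) (?wrap P)" by (rule prefixI) (rule refl)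
    ultimately show ?thesis
      using rise_replicate(1)[of ?a "Suc n"] unfolding W_def band_def balance_eq_rise by blast
  qed
  ultimately have "?wrap Q \<in> W (int (Suc n))" by (rule m)
  then have "rise ?a (?wrap Q) = 0" unfolding W_def balance_eq_rise by blast
  then show False
    using PQ(4) by (simp add: rise_replicate del: replicate_Suc minus_letter_a)
qed

theorem proposition2:
  fixes k :: int
  assumes "k > 0"
  shows "definable_in (W k) (ADT_upto (k + 1)) \<and> \<not> definable_in (W k) (ADT_upto (k - 2))"
proof -
  obtain n where k: "k = int (Suc n)"
    using assms zero_less_imp_eq_int[of k] by (auto simp: gr0_conv_Suc)
  \<comment> \<open>Here \<open>k - 2\<close> is \<open>n - 1\<close>, within the depth handled by
    \<open>not_monotone_W\<close>; for \<open>k = 1\<close> the set of trees is empty.\<close>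
  have "cd t \<le> n" if "t \<in> ADT_upto (k - 2)" for t :: "ap tree"
    using that k by (simp add: ADT_upto_def)
  then have "\<not> definable_in (W k) (ADT_upto (k - 2))"
    unfolding definable_in_def using not_monotone_W[of n] monotone_lang_sem k by metis
  then show ?thesis using definable_W[of n] k by simp
qed

end
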